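(* Let $L=\mathrm{Log}(\{(\mathfrak F,0)\})$ for a single finite frame $\mathfrak F$ rooted at $0$. Let $\varphi$ be a modal formula and $\sigma\subseteq\mathrm{sig}(\varphi)$. If $\xi\in\mathrm{PL}(\sigma_{\mathfrak F})$ is a propositional uniform $\sigma_{\mathfrak F}$-interpolant for $\mathit{tr}_{\mathfrak F,0}(\varphi)$, then $\mathit{rt}_{\mathfrak F,L}(\xi)$ is a strongest $L(\sigma)$-implicate of $\varphi$.
   Context: For $\mathfrak F=(W,R)$ and a signature $\sigma'$, $\sigma'_{\mathfrak F}=\{p_w:p\in\sigma',w\in W\}$. $\mathit{tr}_{\mathfrak F,w}$ maps modal formulas to propositional formulas over these atoms: $p\mapsto p_w$, commuting with $\top,\neg,\wedge$, and $\Diamond\varphi\mapsto\bigvee_{(w,w')\in R}\mathit{tr}_{\mathfrak F,w'}(\varphi)$ ($\Box=\neg\Diamond\neg$). $\mathit{rt}_{\mathfrak F,L}$ (relative to $\sigma$) is defined as follows. Let $N=|W|$, $\Box^{\le N}\psi=\psi\wedge\Box\psi\wedge\dots\wedge\Box^N\psi$, $\Diamond^{\le N}=\neg\Box^{\le N}\neg$. A $\sigma$-EME is a finite set $\Phi$ of propositional formulas over $\sigma$, pairwise inconsistent, with tautological disjunction; it is a $\sigma$-cover of a model if worlds satisfying the same member agree on all atoms of $\sigma$. $\mathit{cover}(\sigma,\Phi)=\bigwedge_{\phi\in\Phi}\bigwedge_{p\in\sigma}(\Diamond^{\le N}(\phi\wedge p)\to\Box^{\le N}(\phi\to p))$. An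 abstract $\Phi$-model for $L$ is $(\mathfrak F,f)$, $f:W\to\Phi$; modal formulas over $\Phi$ treat members of $\Phi$ as atoms ($w\models\phi$ iff $f(w)=\phi$). Abstract $\Phi$-bisimulations: Forth, Back and equal $f$-values on related worlds. An abstract class identifier is a formula $\delta$ over $\Phi$ such that the abstract $\Phi$-models for $L$ satisfying $\delta$ at $0$ form exactly one abstract-$\Phi$-bisimilarity class at the root, denoted $[\delta]_L$. A $\sigma$-encoding for $L$ is $(\Gamma,\{\Delta_\Phi\}_{\Phi\in\Gamma})$, $\Gamma$ a set of $\sigma$-EMEs, $\Delta_\Phi$ sets of abstract class identifiers, such that every model $\mathfrak M$ on $\mathfrak F$ has some $\Phi\in\Gamma$ that is a $\sigma$-cover of $\mathfrak M$ and some $\delta\in\Delta_\Phi$ with $\mathfrak M,0\models\delta$. With a fixed $\sigma$-encoding, $\mathit{rt}_{\mathfrak F,L}(\xi)=\bigwedge_{\Phi\in\Gamma}\bigwedge_{\delta\in\Delta_\Phi}((\mathit{cover}(\sigma,\Phi)\wedge\delta)\to\bigvee_{(\mathfrak F,f)\in[\delta]_L}\xi^f)$, with $\xi^f$ obtained by replacing each $p_w$ by $\Diamond^{\le N}(f(w)\wedge p)$. A propositional uniform $S$-interpolant of $\xi'$: propositional $\chi$ over $S$, $\xi'\to\chi$ tautology, and $\chi\to\psi$ tautology whenever $\mathrm{sig}(\psi)\cap\mathrm{sig}(\xi')\subseteq S$ and $\xi'\to\psi$ tautology. A strongest $L(\sigma)$-implicate of $\varphi$: modal $\chi$ with $\mathrm{sig}(\chi)\subseteq\sigma$,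 $\varphi\to\chi\in L$, and $\chi\to\psi\in L$ for all $\psi$ with $\mathrm{sig}(\psi)\subseteq\sigma$ and $\varphi\to\psi\in L$. $\mathrm{Log}(\{(\mathfrak F,0)\})$: formulas true at $0$ in all models on $\mathfrak F$. *)

theory Defs
  imports Main "HOL-Library.FuncSet"
begin

section \<open>Propositional formulas\<close>

datatype (psig: 'a) pform =
    PAtom 'a
  | PTop
  | PNeg "'a pform"
  | PAnd "'a pform" "'a pform"

abbreviation PBot :: "'a pform" where "PBot \<equiv> PNeg PTop"
abbreviation POr :: "'a pform \<Rightarrow> 'a pform \<Rightarrow> 'a pform" where
  "POr \<phi> \<psi> \<equiv> PNeg (PAnd (PNeg \<phi>) (PNeg \<psi>))"
abbreviation PImp :: "'a pform \<Rightarrow> 'a pform \<Rightarrow> 'a pform" where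
  "PImp \<phi> \<psi> \<equiv> PNeg (PAnd \<phi> (PNeg \<psi>))"

primrec psat :: "('a \<Rightarrow> bool) \<Rightarrow> 'a pform \<Rightarrow> bool" where
  "psat v (PAtom p) = v p"
| "psat v PTop = True"
| "psat v (PNeg \<phi>) = (\<not> psat v \<phi>)"
| "psat v (PAnd \<phi> \<psi>) = (psat v \<phi> \<and> psat v \<psi>)"

definition tautology :: "'a pform \<Rightarrow> bool" where
  "tautology \<phi> \<longleftrightarrow> (\<forall>v. psat v \<phi>)"

text \<open>Conjunctions and disjunctions over finite index sets are formed along an arbitrary but fixed
  enumeration of the index set; for an infinite index set the enumeration is unspecified.\<close>

definition enum_set :: "'i set \<Rightarrow> 'i list" where
  "enum_set I = (SOME xs. distinct xs \<and> set xs = I)"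

definition PDisj :: "'i set \<Rightarrow> ('i \<Rightarrow> 'a pform) \<Rightarrow> 'a pform" where
  "PDisj I \<phi> = foldr POr (map \<phi> (enum_set I)) PBot"

definition uniform_interpolant :: "'a set \<Rightarrow> 'a pform \<Rightarrow> 'a pform \<Rightarrow> bool" where
  "uniform_interpolant S \<xi> \<chi> \<longleftrightarrow>
     psig \<chi> \<subseteq> S \<and> tautology (PImp \<xi> \<chi>) \<and>
     (\<forall>\<psi>. psig \<psi> \<inter> psig \<xi> \<subseteq> S \<and> tautology (PImp \<xi> \<psi>) \<longrightarrow> tautology (PImp \<chi> \<psi>))"


section \<open>Modal formulas, frames and logics\<close>

datatype (msig: 'a) mform =
    MAtom 'a
  | MTop
  | MNeg "'a mform"
  | MAnd "'a mform" "'a mform"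
  | MDia "'a mform"

abbreviation MBot :: "'a mform" where "MBot \<equiv> MNeg MTop"
abbreviation MOr :: "'a mform \<Rightarrow> 'a mform \<Rightarrow> 'a mform" where
  "MOr \<phi> \<psi> \<equiv> MNeg (MAnd (MNeg \<phi>) (MNeg \<psi>))"
abbreviation MImp :: "'a mform \<Rightarrow> 'a mform \<Rightarrow> 'a mform" where
  "MImp \<phi> \<psi> \<equiv> MNeg (MAnd \<phi> (MNeg \<psi>))"
abbreviation MBox :: "'a mform \<Rightarrow> 'a mform" where
  "MBox \<phi> \<equiv> MNeg (MDia (MNeg \<phi>))"

definition MConj :: "'i set \<Rightarrow> ('i \<Rightarrow> 'a mform) \<Rightarrow> 'a mform" where
  "MConj I \<phi> = foldr MAnd (map \<phi> (enum_set I)) MTop"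

definition MDisj :: "'i set \<Rightarrow> ('i \<Rightarrow> 'a mform) \<Rightarrow> 'a mform" where
  "MDisj I \<phi> = foldr MOr (map \<phi> (enum_set I)) MBot"

primrec box_upto :: "nat \<Rightarrow> 'a mform \<Rightarrow> 'a mform" where
  "box_upto 0 \<psi> = \<psi>"
| "box_upto (Suc n) \<psi> = MAnd (box_upto n \<psi>) ((MBox ^^ Suc n) \<psi>)"

definition dia_upto :: "nat \<Rightarrow> 'a mform \<Rightarrow> 'a mform" where
  "dia_upto n \<psi> = MNeg (box_upto n (MNeg \<psi>))"

datatype 'w frame = Frame (worlds: "'w set") (acc: "('w \<times> 'w) set")

definition finite_rooted_frame :: "'w frame \<Rightarrow> 'w \<Rightarrow> bool" where
  "finite_rooted_frame F r \<longleftrightarrow>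
     finite (worlds F) \<and> acc F \<subseteq> worlds F \<times> worlds F \<and> r \<in> worlds F \<and>
     (\<forall>w \<in> worlds F. (r, w) \<in> (acc F)\<^sup>*)"

text \<open>A model on \<open>F\<close> is given by a valuation \<open>V\<close>, where \<open>V w p\<close> says that the atom \<open>p\<close> is true at
  \<open>w\<close>; the values of \<open>V\<close> outside \<open>worlds F\<close> are irrelevant.\<close>

primrec msat :: "'w frame \<Rightarrow> ('w \<Rightarrow> 'a \<Rightarrow> bool) \<Rightarrow> 'w \<Rightarrow> 'a mform \<Rightarrow> bool" where
  "msat F V w (MAtom p) = V w p"
| "msat F V w MTop = True"
| "msat F V w (MNeg \<phi>) = (\<not> msat F V w \<phi>)"
| "msat F V w (MAnd \<phi> \<psi>) = (msat F V w \<phi> \<and> msat F V w \<psi>)"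
| "msat F V w (MDia \<phi>) = (\<exists>w'. (w, w') \<in> acc F \<and> msat F V w' \<phi>)"

definition Log :: "('w frame \<times> 'w) set \<Rightarrow> 'a mform set" where
  "Log K = {\<phi>. \<forall>(F, r) \<in> K. \<forall>V. msat F V r \<phi>}"

definition strongest_implicate :: "'a mform set \<Rightarrow> 'a set \<Rightarrow> 'a mform \<Rightarrow> 'a mform \<Rightarrow> bool" where
  "strongest_implicate L \<sigma> \<phi> \<chi> \<longleftrightarrow>
     msig \<chi> \<subseteq> \<sigma> \<and> MImp \<phi> \<chi> \<in> L \<and>
     (\<forall>\<psi>. msig \<psi> \<subseteq> \<sigma> \<and> MImp \<phi> \<psi> \<in> L \<longrightarrow> MImp \<chi> \<psi> \<in> L)"

primrec pform_subst :: "('a \<Rightarrow> 'b mform) \<Rightarrow> 'a pform \<Rightarrow> 'b mform" where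
  "pform_subst s (PAtom p) = s p"
| "pform_subst s PTop = MTop"
| "pform_subst s (PNeg \<phi>) = MNeg (pform_subst s \<phi>)"
| "pform_subst s (PAnd \<phi> \<psi>) = MAnd (pform_subst s \<phi>) (pform_subst s \<psi>)"

primrec mform_subst :: "('a \<Rightarrow> 'b mform) \<Rightarrow> 'a mform \<Rightarrow> 'b mform" where
  "mform_subst s (MAtom p) = s p"
| "mform_subst s MTop = MTop"
| "mform_subst s (MNeg \<phi>) = MNeg (mform_subst s \<phi>)"
| "mform_subst s (MAnd \<phi> \<psi>) = MAnd (mform_subst s \<phi>) (mform_subst s \<psi>)"
| "mform_subst s (MDia \<phi>) = MDia (mform_subst s \<phi>)"

abbreviation of_pform :: "'a pform \<Rightarrow> 'a mform" where
  "of_pform \<equiv> pform_subst MAtom"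


section \<open>Translation into propositional logic\<close>

text \<open>The atom \<open>p\<^sub>w\<close> is the pair \<open>(p, w)\<close>.\<close>

definition frame_sig :: "'w frame \<Rightarrow> 'a set \<Rightarrow> ('a \<times> 'w) set" where
  "frame_sig F \<sigma> = \<sigma> \<times> worlds F"

primrec tr :: "'w frame \<Rightarrow> 'w \<Rightarrow> 'a mform \<Rightarrow> ('a \<times> 'w) pform" where
  "tr F w (MAtom p) = PAtom (p, w)"
| "tr F w MTop = PTop"
| "tr F w (MNeg \<phi>) = PNeg (tr F w \<phi>)"
| "tr F w (MAnd \<phi> \<psi>) = PAnd (tr F w \<phi>) (tr F w \<psi>)"
| "tr F w (MDia \<phi>) = PDisj {w'. (w, w') \<in> acc F} (\<lambda>w'. tr F w' \<phi>)"


section \<open>Exhaustive sets of mutually exclusive formulas and covers\<close>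

definition EME :: "'a set \<Rightarrow> 'a pform set \<Rightarrow> bool" where
  "EME \<sigma> \<Phi> \<longleftrightarrow>
     finite \<Phi> \<and> (\<forall>\<phi> \<in> \<Phi>. psig \<phi> \<subseteq> \<sigma>) \<and>
     pairwise (\<lambda>\<phi> \<psi>. tautology (PNeg (PAnd \<phi> \<psi>))) \<Phi> \<and>
     tautology (PDisj \<Phi> (\<lambda>\<phi>. \<phi>))"

definition is_cover :: "'w frame \<Rightarrow> ('w \<Rightarrow> 'a \<Rightarrow> bool) \<Rightarrow> 'a set \<Rightarrow> 'a pform set \<Rightarrow> bool" where
  "is_cover F V \<sigma> \<Phi> \<longleftrightarrow>
     (\<forall>\<phi> \<in> \<Phi>. \<forall>w \<in> worlds F. \<forall>w' \<in> worlds F.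
        psat (V w) \<phi> \<and> psat (V w') \<phi> \<longrightarrow> (\<forall>p \<in> \<sigma>. V w p = V w' p))"

definition cover_form :: "nat \<Rightarrow> 'a set \<Rightarrow> 'a pform set \<Rightarrow> 'a mform" where
  "cover_form N \<sigma> \<Phi> = MConj \<Phi> (\<lambda>\<phi>. MConj \<sigma> (\<lambda>p.
     MImp (dia_upto N (MAnd (of_pform \<phi>) (MAtom p)))
          (box_upto N (MImp (of_pform \<phi>) (MAtom p)))))"


section \<open>Abstract models and encodings\<close>

text \<open>An abstract \<open>\<Phi>\<close>-model \<open>(F, f)\<close> is represented by \<open>f\<close>. Extensional functions are used so that
  each map from \<open>worlds F\<close> to \<open>\<Phi>\<close> is represented exactly once; in particular, there are only
  finitely many abstract models. Modal formulas over \<open>\<Phi>\<close> are modal formulas whose atoms are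
  propositional formulas.\<close>

definition abs_models :: "'w frame \<Rightarrow> 'a pform set \<Rightarrow> ('w \<Rightarrow> 'a pform) set" where
  "abs_models F \<Phi> = worlds F \<rightarrow>\<^sub>E \<Phi>"

definition abs_sat :: "'w frame \<Rightarrow> ('w \<Rightarrow> 'a pform) \<Rightarrow> 'w \<Rightarrow> 'a pform mform \<Rightarrow> bool" where
  "abs_sat F f w \<delta> \<longleftrightarrow> msat F (\<lambda>u \<phi>. f u = \<phi>) w \<delta>"

definition abs_bisimulation ::
  "'w frame \<Rightarrow> ('w \<Rightarrow> 'a pform) \<Rightarrow> ('w \<Rightarrow> 'a pform) \<Rightarrow> ('w \<times> 'w) set \<Rightarrow> bool" where
  "abs_bisimulation F f g \<beta> \<longleftrightarrow>
     \<beta> \<subseteq> worlds F \<times> worlds F \<and>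
     (\<forall>(u, v) \<in> \<beta>.
        f u = g v \<and>
        (\<forall>u'. (u, u') \<in> acc F \<longrightarrow> (\<exists>v'. (v, v') \<in> acc F \<and> (u', v') \<in> \<beta>)) \<and>
        (\<forall>v'. (v, v') \<in> acc F \<longrightarrow> (\<exists>u'. (u, u') \<in> acc F \<and> (u', v') \<in> \<beta>)))"

definition abs_bisimilarity ::
  "'w frame \<Rightarrow> 'w \<Rightarrow> 'a pform set \<Rightarrow> (('w \<Rightarrow> 'a pform) \<times> ('w \<Rightarrow> 'a pform)) set" where
  "abs_bisimilarity F r \<Phi> =
     {(f, g). f \<in> abs_models F \<Phi> \<and> g \<in> abs_models F \<Phi> \<and>
              (\<exists>\<beta>. abs_bisimulation F f g \<beta> \<and> (r, r) \<in> \<beta>)}"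

text \<open>\<open>abs_class F r \<Phi> \<delta>\<close> is the set written \<open>[\<delta>]\<^sub>L\<close> for the logic \<open>L\<close> of the pointed frame
  \<open>(F, r)\<close>.\<close>

definition abs_class ::
  "'w frame \<Rightarrow> 'w \<Rightarrow> 'a pform set \<Rightarrow> 'a pform mform \<Rightarrow> ('w \<Rightarrow> 'a pform) set" where
  "abs_class F r \<Phi> \<delta> = {f \<in> abs_models F \<Phi>. abs_sat F f r \<delta>}"

definition abs_class_identifier ::
  "'w frame \<Rightarrow> 'w \<Rightarrow> 'a pform set \<Rightarrow> 'a pform mform \<Rightarrow> bool" where
  "abs_class_identifier F r \<Phi> \<delta> \<longleftrightarrow>
     msig \<delta> \<subseteq> \<Phi> \<and> abs_class F r \<Phi> \<delta> \<in> abs_models F \<Phi> // abs_bisimilarity F r \<Phi>"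

text \<open>Reading a formula over \<open>\<Phi>\<close> as an ordinary modal formula, its atoms are unfolded to the
  propositional formulas they are.\<close>

definition realise :: "'a pform mform \<Rightarrow> 'a mform" where
  "realise \<delta> = mform_subst of_pform \<delta>"

text \<open>The set \<open>\<Gamma>\<close> and the sets \<open>\<Delta> \<Phi>\<close> are required to be finite, since \<open>rt\<close> below is a conjunction
  ranging over them.\<close>

definition encoding ::
  "'w frame \<Rightarrow> 'w \<Rightarrow> 'a set \<Rightarrow> 'a pform set set \<Rightarrow> ('a pform set \<Rightarrow> 'a pform mform set) \<Rightarrow> bool"
where
  "encoding F r \<sigma> \<Gamma> \<Delta> \<longleftrightarrow>
     finite \<Gamma> \<and>
     (\<forall>\<Phi> \<in> \<Gamma>. EME \<sigma> \<Phi> \<and> finite (\<Delta> \<Phi>) \<and> (\<forall>\<delta> \<in> \<Delta> \<Phi>. abs_class_identifier F r \<Phi> \<delta>)) \<and>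
     (\<forall>V. \<exists>\<Phi> \<in> \<Gamma>. is_cover F V \<sigma> \<Phi> \<and> (\<exists>\<delta> \<in> \<Delta> \<Phi>. msat F V r (realise \<delta>)))"

text \<open>\<open>atoms_subst N f \<xi>\<close> is \<open>\<xi>\<^sup>f\<close>.\<close>

definition atoms_subst :: "nat \<Rightarrow> ('w \<Rightarrow> 'a pform) \<Rightarrow> ('a \<times> 'w) pform \<Rightarrow> 'a mform" where
  "atoms_subst N f \<xi> =
     pform_subst (\<lambda>(p, w). dia_upto N (MAnd (of_pform (f w)) (MAtom p))) \<xi>"

definition rt ::
  "'w frame \<Rightarrow> 'w \<Rightarrow> 'a set \<Rightarrow> 'a pform set set \<Rightarrow> ('a pform set \<Rightarrow> 'a pform mform set) \<Rightarrow>
   ('a \<times> 'w) pform \<Rightarrow> 'a mform" where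
  "rt F r \<sigma> \<Gamma> \<Delta> \<xi> =
     (let N = card (worlds F) in
      MConj \<Gamma> (\<lambda>\<Phi>. MConj (\<Delta> \<Phi>) (\<lambda>\<delta>.
        MImp (MAnd (cover_form N \<sigma> \<Phi>) (realise \<delta>))
             (MDisj (abs_class F r \<Phi> \<delta>) (\<lambda>f. atoms_subst N f \<xi>)))))"

end

theory Submission
  imports Defs
begin

text \<open>
  Because \<open>F\<close> is finite and rooted, \<open>\<box>\<^sup>\<le>\<^sup>N\<close> at the root quantifies over all worlds. Given a model
  \<open>V\<close> and an EME \<open>\<Phi>\<close>, let \<open>g\<close> map each world to the member of \<open>\<Phi>\<close> true there; \<open>g\<close> satisfies \<open>\<delta>\<close>
  iff \<open>V\<close> satisfies the unfolding of \<open>\<delta>\<close>. At the root, \<open>\<xi>\<^sup>f\<close> says that \<open>\<xi>\<close> holds in the pulled-back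
  valuation that makes \<open>p\<close> true at \<open>w\<close> iff \<open>p\<close> is true in \<open>V\<close> at some \<open>u\<close> with \<open>g u = f w\<close>. If \<open>\<Phi>\<close>
  covers \<open>V\<close>, the pullback along \<open>f = g\<close> is \<open>V\<close> itself, which shows that \<open>\<phi>\<close> implies \<open>rt \<xi>\<close>; and for
  \<open>f\<close> in the class of \<open>g\<close>, an abstract bisimulation between \<open>f\<close> and \<open>g\<close> is a \<open>\<sigma>\<close>-bisimulation between
  the pullback and \<open>V\<close>. So if \<open>rt \<xi>\<close> holds in \<open>V\<close> then some pullback bisimilar to \<open>V\<close> satisfies \<open>\<xi>\<close>,
  hence every \<open>\<sigma>\<close>-consequence of \<open>\<phi>\<close>, and this transfers back to \<open>V\<close>.
\<close>

section \<open>Semantics and signatures of the derived connectives\<close>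

lemma set_enum_set:
  assumes "finite I"
  shows "set (enum_set I) = I"
proof -
  have "\<exists>xs. distinct xs \<and> set xs = I" using finite_distinct_list[OF assms] by blast
  then show ?thesis unfolding enum_set_def by (rule someI2_ex) simp
qed

lemma psat_PDisj: "finite I \<Longrightarrow> psat v (PDisj I \<phi>) \<longleftrightarrow> (\<exists>i\<in>I. psat v (\<phi> i))"
proof -
  have "psat v (foldr POr (map \<phi> xs) PBot) \<longleftrightarrow> (\<exists>i\<in>set xs. psat v (\<phi> i))" for xs
    by (induction xs) auto
  then show "finite I \<Longrightarrow> ?thesis" by (simp add: PDisj_def set_enum_set)
qed

lemma psig_PDisj: "finite I \<Longrightarrow> psig (PDisj I \<phi>) = (\<Union>i\<in>I. psig (\<phi> i))"
proof -
  have "psig (foldr POr (map \<phi> xs) PBot) = (\<Union>i\<in>set xs. psig (\<phi> i))" for xs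
    by (induction xs) auto
  then show "finite I \<Longrightarrow> ?thesis" by (simp add: PDisj_def set_enum_set)
qed

lemma msat_MConj: "finite I \<Longrightarrow> msat F V w (MConj I \<phi>) \<longleftrightarrow> (\<forall>i\<in>I. msat F V w (\<phi> i))"
proof -
  have "msat F V w (foldr MAnd (map \<phi> xs) MTop) \<longleftrightarrow> (\<forall>i\<in>set xs. msat F V w (\<phi> i))" for xs
    by (induction xs) auto
  then show "finite I \<Longrightarrow> ?thesis" by (simp add: MConj_def set_enum_set)
qed

lemma msig_MConj: "finite I \<Longrightarrow> msig (MConj I \<phi>) = (\<Union>i\<in>I. msig (\<phi> i))"
proof -
  have "msig (foldr MAnd (map \<phi> xs) MTop) = (\<Union>i\<in>set xs. msig (\<phi> i))" for xs
    by (induction xs) auto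
  then show "finite I \<Longrightarrow> ?thesis" by (simp add: MConj_def set_enum_set)
qed

lemma msat_MDisj: "finite I \<Longrightarrow> msat F V w (MDisj I \<phi>) \<longleftrightarrow> (\<exists>i\<in>I. msat F V w (\<phi> i))"
proof -
  have "msat F V w (foldr MOr (map \<phi> xs) MBot) \<longleftrightarrow> (\<exists>i\<in>set xs. msat F V w (\<phi> i))" for xs
    by (induction xs) auto
  then show "finite I \<Longrightarrow> ?thesis" by (simp add: MDisj_def set_enum_set)
qed

lemma msig_MDisj: "finite I \<Longrightarrow> msig (MDisj I \<phi>) = (\<Union>i\<in>I. msig (\<phi> i))"
proof -
  have "msig (foldr MOr (map \<phi> xs) MBot) = (\<Union>i\<in>set xs. msig (\<phi> i))" for xs
    by (induction xs) auto
  then show "finite I \<Longrightarrow> ?thesis" by (simp add: MDisj_def set_enum_set)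
qed

lemma msig_box_pow: "msig ((MBox ^^ n) \<psi>) = msig \<psi>"
  by (induction n) auto

lemma msig_box_upto: "msig (box_upto n \<psi>) = msig \<psi>"
proof (induction n)
  case (Suc n)
  then show ?case using msig_box_pow[of "Suc n" \<psi>] by simp
qed simp

lemma msig_dia_upto: "msig (dia_upto n \<psi>) = msig \<psi>"
  by (simp add: dia_upto_def msig_box_upto)

lemma msig_pform_subst: "msig (pform_subst s \<phi>) = (\<Union>p\<in>psig \<phi>. msig (s p))"
  by (induction \<phi>) auto

lemma msig_mform_subst: "msig (mform_subst s \<phi>) = (\<Union>p\<in>msig \<phi>. msig (s p))"
  by (induction \<phi>) auto

section \<open>Bounded modalities and reachability from the root\<close>

lemma msat_box_pow: "msat F V w ((MBox ^^ n) \<psi>) \<longleftrightarrow> (\<forall>u. (w, u) \<in> acc F ^^ n \<longrightarrow> msat F V u \<psi>)"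
proof (induction n arbitrary: w)
  case (Suc n)
  have "msat F V w ((MBox ^^ Suc n) \<psi>) \<longleftrightarrow>
      (\<forall>v u. (w, v) \<in> acc F \<longrightarrow> (v, u) \<in> acc F ^^ n \<longrightarrow> msat F V u \<psi>)"
    by (auto simp: Suc.IH)
  also have "\<dots> \<longleftrightarrow> (\<forall>u. (w, u) \<in> acc F ^^ Suc n \<longrightarrow> msat F V u \<psi>)"
    \<comment> \<open>The outermost box is the first step of the path, whereas \<open>relpow\<close>
      by definition splits off the last one.\<close>
    by (meson relpow_Suc_D2 relpow_Suc_I2)
  finally show ?case .
qed simp

lemma msat_box_upto:
  "msat F V w (box_upto N \<psi>) \<longleftrightarrow> (\<forall>n\<le>N. \<forall>u. (w, u) \<in> acc F ^^ n \<longrightarrow> msat F V u \<psi>)"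
proof (induction N)
  case (Suc N)
  have "msat F V w (box_upto (Suc N) \<psi>) \<longleftrightarrow>
      msat F V w (box_upto N \<psi>) \<and> msat F V w ((MBox ^^ Suc N) \<psi>)"
    by (simp only: box_upto.simps msat.simps)
  then show ?case unfolding Suc.IH msat_box_pow by (metis le_Suc_eq)
qed simp

lemma msat_pform_subst: "msat F V w (pform_subst s \<phi>) \<longleftrightarrow> psat (\<lambda>p. msat F V w (s p)) \<phi>"
  by (induction \<phi>) auto

lemma psat_cong: "(\<And>p. p \<in> psig \<phi> \<Longrightarrow> v p = v' p) \<Longrightarrow> psat v \<phi> \<longleftrightarrow> psat v' \<phi>"
  by (induction \<phi>) auto

text \<open>The worlds on a shortest path to \<open>u\<close> have pairwise different distances from
  \<open>r\<close>, so \<open>dist\<close> takes at least \<open>dist u + 1\<close> values on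
  \<open>W\<close>.\<close>

lemma relpow_within_card:
  assumes "finite W" "R \<subseteq> W \<times> W" "r \<in> W" "(r, u) \<in> R\<^sup>*"
  obtains n where "n \<le> card W" "(r, u) \<in> R ^^ n"
proof -
  define dist where "dist w = (LEAST n. (r, w) \<in> R ^^ n)" for w
  have ex: "\<exists>n. (r, u) \<in> R ^^ n" using assms(4) by (simp add: rtrancl_power)
  then have u: "(r, u) \<in> R ^^ dist u" unfolding dist_def by (rule LeastI_ex)
  \<comment> \<open>Every distance up to that of \<open>u\<close> is attained along a shortest path to \<open>u\<close>.\<close>
  have "k \<in> dist ` W" if "k \<le> dist u" for k
  proof -
    have "(r, u) \<in> R ^^ k O R ^^ (dist u - k)"
      using u that by (metis le_add_diff_inverse relpow_add)
    then obtain w where w: "(r, w) \<in> R ^^ k" "(w, u) \<in> R ^^ (dist u - k)" by blast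
    \<comment> \<open>A shortcut to \<open>w\<close>, followed by the rest of the path, would
      undercut \<open>dist u\<close>.\<close>
    have "k \<le> m" if m: "(r, w) \<in> R ^^ m" for m
    proof -
      have "(r, u) \<in> R ^^ (m + (dist u - k))" using m w(2) by (auto simp: relpow_add)
      then have "dist u \<le> m + (dist u - k)" unfolding dist_def[of u] by (rule Least_le)
      with \<open>k \<le> dist u\<close> show ?thesis by linarith
    qed
    then have "dist w = k" unfolding dist_def using w(1) by (intro Least_equality)
    moreover have "(r, w) \<in> R\<^sup>*" using w(1) by (rule relpow_imp_rtrancl)
    then have "w \<in> W" by (induction rule: rtrancl_induct) (use assms in auto)
    ultimately show ?thesis by blast
  qed
  then have "{..dist u} \<subseteq> dist ` W" by blast
  then have "card {..dist u} \<le> card W"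
    using assms(1) by (meson card_image_le card_mono finite_imageI le_trans)
  then have "dist u \<le> card W" by simp
  then show ?thesis using u by (rule that)
qed

lemma msat_box_upto_root:
  assumes "finite_rooted_frame F r"
  shows "msat F V r (box_upto (card (worlds F)) \<psi>) \<longleftrightarrow> (\<forall>u\<in>worlds F. msat F V u \<psi>)"
proof -
  have F: "finite (worlds F)" "acc F \<subseteq> worlds F \<times> worlds F" "r \<in> worlds F"
    "\<forall>w\<in>worlds F. (r, w) \<in> (acc F)\<^sup>*" using assms by (auto simp: finite_rooted_frame_def)
  have "u \<in> worlds F" if "(r, u) \<in> acc F ^^ n" for n u
    using relpow_imp_rtrancl[OF that] by (induction rule: rtrancl_induct) (use F in auto)
  moreover have "\<exists>n\<le>card (worlds F). (r, u) \<in> acc F ^^ n" if "u \<in> worlds F" for u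
    using relpow_within_card[OF F(1-3)] F(4) that by metis
  ultimately show ?thesis unfolding msat_box_upto by blast
qed

lemma msat_dia_upto_root:
  assumes "finite_rooted_frame F r"
  shows "msat F V r (dia_upto (card (worlds F)) \<psi>) \<longleftrightarrow> (\<exists>u\<in>worlds F. msat F V u \<psi>)"
  by (simp add: dia_upto_def msat_box_upto_root[OF assms])

section \<open>The translation \<open>tr\<close>\<close>

lemma finite_successors: "finite_rooted_frame F r \<Longrightarrow> finite {w'. (w, w') \<in> acc F}"
  by (rule finite_subset[of _ "worlds F"]) (auto simp: finite_rooted_frame_def)

text \<open>A valuation of the atoms \<open>(p, w)\<close> is an uncurried Kripke valuation, and
  \<open>tr\<close> expands each diamond over the finitely many successors.\<close>

lemma psat_tr:
  assumes "finite_rooted_frame F r"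
  shows "psat v (tr F w \<phi>) \<longleftrightarrow> msat F (\<lambda>u p. v (p, u)) w \<phi>"
  by (induction \<phi> arbitrary: w) (auto simp: psat_PDisj finite_successors[OF assms])

lemma psig_tr:
  assumes "finite_rooted_frame F r" "w \<in> worlds F"
  shows "psig (tr F w \<phi>) \<subseteq> frame_sig F (msig \<phi>)"
  using assms(2)
proof (induction \<phi> arbitrary: w)
  case (MDia \<phi>)
  then show ?case using assms(1)
    by (fastforce simp: psig_PDisj finite_successors[OF assms(1)] finite_rooted_frame_def)
qed (auto simp: frame_sig_def)

lemma MImp_mem_Log: "MImp \<phi> \<psi> \<in> Log {(F, r)} \<longleftrightarrow> (\<forall>V. msat F V r \<phi> \<longrightarrow> msat F V r \<psi>)"
  by (simp add: Log_def)

text \<open>Turns modal consequences into tautologies, the only consequences that a uniform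
  interpolant speaks about.\<close>

lemma tautology_tr_iff:
  assumes "finite_rooted_frame F r"
  shows "tautology (PImp (tr F r \<phi>) (tr F r \<psi>)) \<longleftrightarrow> MImp \<phi> \<psi> \<in> Log {(F, r)}"
proof
  assume l: "tautology (PImp (tr F r \<phi>) (tr F r \<psi>))"
  have "msat F V r \<phi> \<longrightarrow> msat F V r \<psi>" for V
    using l[unfolded tautology_def, rule_format, of "\<lambda>(p, w). V w p"]
    by (simp add: psat_tr[OF assms])
  then show "MImp \<phi> \<psi> \<in> Log {(F, r)}" by (simp add: MImp_mem_Log)
qed (simp add: MImp_mem_Log tautology_def psat_tr[OF assms])

section \<open>Abstracting a model by an EME\<close>

lemma EME_unique:
  assumes "EME \<sigma> \<Phi>"
  shows "\<exists>!\<phi>. \<phi> \<in> \<Phi> \<and> psat v \<phi>"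
proof -
  have "\<exists>\<phi>\<in>\<Phi>. psat v \<phi>"
    using assms by (auto simp: EME_def tautology_def psat_PDisj)
  moreover have "\<phi> = \<psi>" if "\<phi> \<in> \<Phi>" "\<psi> \<in> \<Phi>" "psat v \<phi>" "psat v \<psi>" for \<phi> \<psi>
    using assms that unfolding EME_def tautology_def pairwise_def psat.simps by blast
  ultimately show ?thesis by blast
qed

text \<open>The map \<open>g\<close> of the overview. Restricting it to \<open>worlds F\<close>
  makes it extensional, as \<open>abs_models\<close> demands; \<open>EME_unique\<close> justifies
  \<open>THE\<close>.\<close>

definition abstraction :: "'w frame \<Rightarrow> ('w \<Rightarrow> 'a \<Rightarrow> bool) \<Rightarrow> 'a pform set \<Rightarrow> 'w \<Rightarrow> 'a pform" where
  "abstraction F V \<Phi> = (\<lambda>w\<in>worlds F. THE \<phi>. \<phi> \<in> \<Phi> \<and> psat (V w) \<phi>)"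

lemma abstraction_mem:
  assumes "EME \<sigma> \<Phi>" "w \<in> worlds F"
  shows "abstraction F V \<Phi> w \<in> \<Phi>"
  using theI'[OF EME_unique[OF assms(1), of "V w"]] assms(2) by (simp add: abstraction_def)

lemma abstraction_eq_iff:
  assumes "EME \<sigma> \<Phi>" "w \<in> worlds F" "\<phi> \<in> \<Phi>"
  shows "abstraction F V \<Phi> w = \<phi> \<longleftrightarrow> psat (V w) \<phi>"
  using EME_unique[OF assms(1), of "V w"] theI'[OF EME_unique[OF assms(1), of "V w"]] assms
  by (auto simp: abstraction_def)

lemma abstraction_in_abs_models: "EME \<sigma> \<Phi> \<Longrightarrow> abstraction F V \<Phi> \<in> abs_models F \<Phi>"
  unfolding abs_models_def
  by (rule PiE_I) (blast intro: abstraction_mem, simp add: abstraction_def)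

lemma finite_abs_models:
  "finite_rooted_frame F r \<Longrightarrow> EME \<sigma> \<Phi> \<Longrightarrow> finite (abs_models F \<Phi>)"
  by (auto simp: abs_models_def finite_rooted_frame_def EME_def intro: finite_PiE)

lemma msat_of_pform: "msat F V w (of_pform \<phi>) \<longleftrightarrow> psat (V w) \<phi>"
  by (simp add: msat_pform_subst)

text \<open>Only atoms need an argument, and there \<open>abstraction_eq_iff\<close> applies because
  the atoms of \<delta> belong to \<Phi>.\<close>

lemma msat_realise:
  assumes "finite_rooted_frame F r" "EME \<sigma> \<Phi>" "msig \<delta> \<subseteq> \<Phi>" "w \<in> worlds F"
  shows "msat F V w (realise \<delta>) \<longleftrightarrow> abs_sat F (abstraction F V \<Phi>) w \<delta>"
  using assms(3,4)
proof (induction \<delta> arbitrary: w)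
  case (MAtom \<phi>)
  then show ?case using abstraction_eq_iff[OF assms(2) MAtom(2), of \<phi> V]
    by (simp add: realise_def abs_sat_def msat_of_pform)
next
  case (MDia \<delta>)
  have "w' \<in> worlds F" if "(w, w') \<in> acc F" for w'
    using assms(1) that by (auto simp: finite_rooted_frame_def)
  with MDia show ?case by (auto simp: realise_def abs_sat_def)
qed (auto simp: realise_def abs_sat_def)

text \<open>At the root, the conjunct for \<phi> and \<open>p\<close> says that if some \<phi>-world
  satisfies \<open>p\<close>, then all of them do.\<close>

lemma msat_cover_form:
  assumes "finite_rooted_frame F r" "finite \<sigma>" "EME \<sigma> \<Phi>"
  shows "msat F V r (cover_form (card (worlds F)) \<sigma> \<Phi>) \<longleftrightarrow> is_cover F V \<sigma> \<Phi>"
proof -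
  have "finite \<Phi>" using assms(3) by (simp add: EME_def)
  then show ?thesis using assms(2)
    unfolding cover_form_def is_cover_def
    by (simp add: msat_MConj msat_box_upto_root[OF assms(1)] msat_dia_upto_root[OF assms(1)]
        msat_of_pform) blast
qed

section \<open>Pulling a valuation back along an abstract model\<close>

definition pullback ::
  "'w frame \<Rightarrow> ('w \<Rightarrow> 'a \<Rightarrow> bool) \<Rightarrow> 'a pform set \<Rightarrow> ('w \<Rightarrow> 'a pform) \<Rightarrow> 'w \<Rightarrow> 'a \<Rightarrow> bool" where
  "pullback F V \<Phi> f w p \<longleftrightarrow> (\<exists>u\<in>worlds F. abstraction F V \<Phi> u = f w \<and> V u p)"

text \<open>The world \<open>v\<close> is itself a possible witness, and every other witness
  satisfies the same member of \<Phi> as \<open>v\<close>, so the cover forces agreement on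
  \<open>p\<close>.\<close>

lemma pullback_eq:
  assumes "EME \<sigma> \<Phi>" "is_cover F V \<sigma> \<Phi>" "v \<in> worlds F" "f u = abstraction F V \<Phi> v" "p \<in> \<sigma>"
  shows "pullback F V \<Phi> f u p \<longleftrightarrow> V v p"
proof -
  let ?g = "abstraction F V \<Phi>"
  have "V w p = V v p" if w: "w \<in> worlds F" "?g w = ?g v" for w
  proof -
    have g: "?g v \<in> \<Phi>" using assms(1,3) by (rule abstraction_mem)
    have "psat (V v) (?g v)" "psat (V w) (?g v)"
      by (rule iffD1[OF abstraction_eq_iff[OF assms(1,3) g] refl],
          rule iffD1[OF abstraction_eq_iff[OF assms(1) w(1) g] w(2)])
    then show ?thesis using assms(2,3,5) w(1) g unfolding is_cover_def by blast
  qed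
  then show ?thesis using assms(3,4) unfolding pullback_def by metis
qed

text \<open>The existential in \<open>pullback\<close> is the meaning of \<open>dia_upto\<close> at
  the root. The bound on the signature of \<xi> keeps \<open>w\<close> in \<open>worlds F\<close>,
  where \<open>f w\<close> lies in \<Phi>.\<close>

lemma msat_atoms_subst:
  assumes "finite_rooted_frame F r" "EME \<sigma> \<Phi>" "f \<in> abs_models F \<Phi>" "psig \<xi> \<subseteq> frame_sig F \<tau>"
  shows "msat F V r (atoms_subst (card (worlds F)) f \<xi>) \<longleftrightarrow> psat (\<lambda>(p, w). pullback F V \<Phi> f w p) \<xi>"
  unfolding atoms_subst_def msat_pform_subst
proof (rule psat_cong)
  fix x assume "x \<in> psig \<xi>"
  then obtain p w where x: "x = (p, w)" and w: "w \<in> worlds F"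
    using assms(4) by (auto simp: frame_sig_def)
  have "f w \<in> \<Phi>" using assms(3) w by (auto simp: abs_models_def)
  then show "msat F V r (case x of (p, w) \<Rightarrow>
      dia_upto (card (worlds F)) (MAnd (of_pform (f w)) (MAtom p))) =
      (case x of (p, w) \<Rightarrow> pullback F V \<Phi> f w p)"
    by (auto simp: x msat_dia_upto_root[OF assms(1)] msat_of_pform pullback_def
        abstraction_eq_iff[OF assms(2)])
qed

section \<open>Abstract bisimulations and invariance\<close>

lemma abs_bisimulation_converse:
  "abs_bisimulation F f g \<beta> \<Longrightarrow> abs_bisimulation F g f (\<beta>\<inverse>)"
  unfolding abs_bisimulation_def by auto

lemma abs_bisimulation_relcomp:
  assumes "abs_bisimulation F f g \<beta>" "abs_bisimulation F g h \<gamma>"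
  shows "abs_bisimulation F f h (\<beta> O \<gamma>)"
proof -
  have 1: "f u = g v" "\<And>u'. (u, u') \<in> acc F \<Longrightarrow> \<exists>v'. (v, v') \<in> acc F \<and> (u', v') \<in> \<beta>"
    "\<And>v'. (v, v') \<in> acc F \<Longrightarrow> \<exists>u'. (u, u') \<in> acc F \<and> (u', v') \<in> \<beta>" if "(u, v) \<in> \<beta>" for u v
    using assms(1) that by (auto simp: abs_bisimulation_def)
  have 2: "g u = h v" "\<And>u'. (u, u') \<in> acc F \<Longrightarrow> \<exists>v'. (v, v') \<in> acc F \<and> (u', v') \<in> \<gamma>"
    "\<And>v'. (v, v') \<in> acc F \<Longrightarrow> \<exists>u'. (u, u') \<in> acc F \<and> (u', v') \<in> \<gamma>" if "(u, v) \<in> \<gamma>" for u v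
    using assms(2) that by (auto simp: abs_bisimulation_def)
  have "\<beta> O \<gamma> \<subseteq> worlds F \<times> worlds F"
    using assms by (auto simp: abs_bisimulation_def)
  moreover have "f u = h w" if "(u, v) \<in> \<beta>" "(v, w) \<in> \<gamma>" for u v w
    using 1(1) 2(1) that by metis
  moreover have "\<exists>w'. (w, w') \<in> acc F \<and> (u', w') \<in> \<beta> O \<gamma>"
    if "(u, v) \<in> \<beta>" "(v, w) \<in> \<gamma>" "(u, u') \<in> acc F" for u v w u'
    using 1(2) 2(2) that by (meson relcompI)
  moreover have "\<exists>u'. (u, u') \<in> acc F \<and> (u', w') \<in> \<beta> O \<gamma>"
    if "(u, v) \<in> \<beta>" "(v, w) \<in> \<gamma>" "(w, w') \<in> acc F" for u v w w'
    using 1(3) 2(3) that by (meson relcompI)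
  ultimately show ?thesis unfolding abs_bisimulation_def by blast
qed

text \<open>The class is the image of one representative \<open>h\<close>, so \<open>f\<close> and
  \<open>g\<close> are linked through \<open>h\<close> by a converse and a composition.\<close>

lemma abs_class_bisimilar:
  assumes "abs_class_identifier F r \<Phi> \<delta>" "f \<in> abs_class F r \<Phi> \<delta>" "g \<in> abs_class F r \<Phi> \<delta>"
  obtains \<beta> where "abs_bisimulation F f g \<beta>" "(r, r) \<in> \<beta>"
proof -
  obtain h where h: "abs_class F r \<Phi> \<delta> = abs_bisimilarity F r \<Phi> `` {h}"
    using assms(1) by (auto simp: abs_class_identifier_def elim: quotientE)
  obtain \<beta> \<gamma> where
    "abs_bisimulation F h f \<beta>" "(r, r) \<in> \<beta>" "abs_bisimulation F h g \<gamma>" "(r, r) \<in> \<gamma>"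
    using assms(2,3) unfolding h abs_bisimilarity_def by blast
  then show ?thesis
    using that[of "\<beta>\<inverse> O \<gamma>"] abs_bisimulation_converse abs_bisimulation_relcomp by blast
qed

text \<open>Related worlds have \<open>f u\<close> equal to the abstraction at \<open>v\<close>,
  which settles atoms by \<open>pullback_eq\<close>; Forth and Back settle the diamond.\<close>

lemma msat_pullback:
  assumes "EME \<sigma> \<Phi>" "is_cover F V \<sigma> \<Phi>" "abs_bisimulation F f (abstraction F V \<Phi>) \<beta>"
    and "(u, v) \<in> \<beta>" "msig \<psi> \<subseteq> \<sigma>"
  shows "msat F (pullback F V \<Phi> f) u \<psi> \<longleftrightarrow> msat F V v \<psi>"
  using assms(4,5)
proof (induction \<psi> arbitrary: u v)
  case (MAtom p)
  then have "v \<in> worlds F" "f u = abstraction F V \<Phi> v"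
    using assms(3) by (auto simp: abs_bisimulation_def)
  with MAtom show ?case by (simp add: pullback_eq[OF assms(1,2)])
next
  case (MDia \<psi>)
  have zig: "\<exists>v'. (v, v') \<in> acc F \<and> (u', v') \<in> \<beta>" if "(u, u') \<in> acc F" for u'
    using assms(3) MDia.prems(1) that unfolding abs_bisimulation_def by blast
  have zag: "\<exists>u'. (u, u') \<in> acc F \<and> (u', v') \<in> \<beta>" if "(v, v') \<in> acc F" for v'
    using assms(3) MDia.prems(1) that unfolding abs_bisimulation_def by blast
  from MDia.prems(2) have "msig \<psi> \<subseteq> \<sigma>" by simp
  then show ?case using zig zag MDia.IH by simp metis
qed auto

section \<open>Semantics and signature of \<open>rt\<close>\<close>

lemma finite_msig: "finite (msig \<phi>)"
  by (induction \<phi>) auto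

lemma finite_abs_class:
  "finite_rooted_frame F r \<Longrightarrow> EME \<sigma> \<Phi> \<Longrightarrow> finite (abs_class F r \<Phi> \<delta>)"
  unfolding abs_class_def using finite_abs_models by (metis finite_Collect_conjI Collect_mem_eq)

text \<open>Finiteness of \<sigma>, \<Gamma>, each \<open>\<Delta> \<Phi>\<close> and each class
  gives the big connectives their intended meaning.\<close>

lemma msat_rt:
  assumes "finite_rooted_frame F r" "finite \<sigma>" "encoding F r \<sigma> \<Gamma> \<Delta>" "psig \<xi> \<subseteq> frame_sig F \<sigma>"
  shows "msat F V r (rt F r \<sigma> \<Gamma> \<Delta> \<xi>) \<longleftrightarrow>
    (\<forall>\<Phi>\<in>\<Gamma>. \<forall>\<delta>\<in>\<Delta> \<Phi>. is_cover F V \<sigma> \<Phi> \<and> msat F V r (realise \<delta>) \<longrightarrow>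
      (\<exists>f\<in>abs_class F r \<Phi> \<delta>. psat (\<lambda>(p, w). pullback F V \<Phi> f w p) \<xi>))"
proof -
  have \<Gamma>: "finite \<Gamma>" "\<And>\<Phi>. \<Phi> \<in> \<Gamma> \<Longrightarrow> EME \<sigma> \<Phi>" "\<And>\<Phi>. \<Phi> \<in> \<Gamma> \<Longrightarrow> finite (\<Delta> \<Phi>)"
    using assms(3) by (auto simp: encoding_def)
  have "msat F V r (MDisj (abs_class F r \<Phi> \<delta>) (\<lambda>f. atoms_subst (card (worlds F)) f \<xi>)) \<longleftrightarrow>
      (\<exists>f\<in>abs_class F r \<Phi> \<delta>. psat (\<lambda>(p, w). pullback F V \<Phi> f w p) \<xi>)" if "\<Phi> \<in> \<Gamma>" for \<Phi> \<delta>
    unfolding msat_MDisj[OF finite_abs_class[OF assms(1) \<Gamma>(2)[OF that]]]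
    by (intro bex_cong refl msat_atoms_subst[OF assms(1) \<Gamma>(2)[OF that] _ assms(4)])
      (simp add: abs_class_def)
  then show ?thesis
    by (auto simp: rt_def Let_def msat_MConj \<Gamma> msat_cover_form[OF assms(1,2)])
qed

lemma msig_rt:
  assumes "finite_rooted_frame F r" "finite \<sigma>" "encoding F r \<sigma> \<Gamma> \<Delta>" "psig \<xi> \<subseteq> frame_sig F \<sigma>"
  shows "msig (rt F r \<sigma> \<Gamma> \<Delta> \<xi>) \<subseteq> \<sigma>"
proof -
  have \<Gamma>: "finite \<Gamma>" "\<And>\<Phi>. \<Phi> \<in> \<Gamma> \<Longrightarrow> EME \<sigma> \<Phi>" "\<And>\<Phi>. \<Phi> \<in> \<Gamma> \<Longrightarrow> finite (\<Delta> \<Phi>)"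
    "\<And>\<Phi> \<delta>. \<Phi> \<in> \<Gamma> \<Longrightarrow> \<delta> \<in> \<Delta> \<Phi> \<Longrightarrow> msig \<delta> \<subseteq> \<Phi>"
    using assms(3) by (auto simp: encoding_def abs_class_identifier_def)
  have \<Phi>: "finite \<Phi>" "\<And>\<phi>. \<phi> \<in> \<Phi> \<Longrightarrow> msig (of_pform \<phi>) \<subseteq> \<sigma>" if "\<Phi> \<in> \<Gamma>" for \<Phi>
    using \<Gamma>(2)[OF that] by (auto simp: EME_def msig_pform_subst)
  have "msig (cover_form N \<sigma> \<Phi>) \<subseteq> \<sigma>" if "\<Phi> \<in> \<Gamma>" for \<Phi> N
    using \<Phi>[OF that] assms(2)
    by (auto simp: cover_form_def msig_MConj msig_box_upto msig_dia_upto)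
  moreover have "msig (realise \<delta>) \<subseteq> \<sigma>" if "\<Phi> \<in> \<Gamma>" "\<delta> \<in> \<Delta> \<Phi>" for \<Phi> \<delta>
    using \<Phi>[OF that(1)] \<Gamma>(4)[OF that] by (auto simp: realise_def msig_mform_subst)
  moreover have "msig (MDisj (abs_class F r \<Phi> \<delta>) (\<lambda>f. atoms_subst N f \<xi>)) \<subseteq> \<sigma>"
    if "\<Phi> \<in> \<Gamma>" for \<Phi> \<delta> N
  proof -
    have "msig (atoms_subst N f \<xi>) \<subseteq> \<sigma>" if f: "f \<in> abs_class F r \<Phi> \<delta>" for f
    proof -
      \<comment> \<open>Outside \<open>worlds F\<close> the value \<open>f w\<close> is
        \<open>undefined\<close>, with no control over its atoms; \<open>frame_sig\<close> keeps
        such \<open>w\<close> out of \<xi>.\<close>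
      have "f w \<in> \<Phi>" if "w \<in> worlds F" for w
        using f that by (auto simp: abs_class_def abs_models_def)
      then have "msig (of_pform (f w)) \<subseteq> \<sigma>" if "w \<in> worlds F" for w
        using \<Phi>(2)[OF \<open>\<Phi> \<in> \<Gamma>\<close>] that by blast
      then show ?thesis using assms(4)
        by (fastforce simp: atoms_subst_def msig_pform_subst[of _ \<xi>] msig_dia_upto frame_sig_def)
    qed
    then show ?thesis
      using msig_MDisj[OF finite_abs_class[OF assms(1) \<Gamma>(2)[OF that]]] by fastforce
  qed
  ultimately show ?thesis
    by (auto simp: rt_def Let_def msig_MConj \<Gamma> subset_eq)
qed

theorem theorem4p8:
  fixes F :: "'w frame" and r :: 'w
    and L :: "'a mform set"
    and \<phi> :: "'a mform" and \<sigma> :: "'a set"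
    and \<Gamma> :: "'a pform set set" and \<Delta> :: "'a pform set \<Rightarrow> 'a pform mform set"
    and \<xi> :: "('a \<times> 'w) pform"
  assumes "finite_rooted_frame F r"
    and "L = Log {(F, r)}"
    and "\<sigma> \<subseteq> msig \<phi>"
    and "encoding F r \<sigma> \<Gamma> \<Delta>"
    and "psig \<xi> \<subseteq> frame_sig F \<sigma>"
    and "uniform_interpolant (frame_sig F \<sigma>) (tr F r \<phi>) \<xi>"
  shows "strongest_implicate L \<sigma> \<phi> (rt F r \<sigma> \<Gamma> \<Delta> \<xi>)"
proof -
  have fin: "finite \<sigma>" using assms(3) finite_msig finite_subset by blast
  have r: "r \<in> worlds F" using assms(1) by (simp add: finite_rooted_frame_def)
  note rt = msat_rt[OF assms(1) fin assms(4,5)]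
  have eme: "EME \<sigma> \<Phi>" if "\<Phi> \<in> \<Gamma>" for \<Phi>
    using assms(4) that by (simp add: encoding_def)
  have ident: "abs_class_identifier F r \<Phi> \<delta>" if "\<Phi> \<in> \<Gamma>" "\<delta> \<in> \<Delta> \<Phi>" for \<Phi> \<delta>
    using assms(4) that by (simp add: encoding_def)
  \<comment> \<open>The abstraction of \<open>V\<close> serves twice: as the true disjunct when
    \<phi> holds, and as the bisimilar partner of \<open>f\<close> in the converse
    direction.\<close>
  have g_class: "abstraction F V \<Phi> \<in> abs_class F r \<Phi> \<delta>"
    if "\<Phi> \<in> \<Gamma>" "\<delta> \<in> \<Delta> \<Phi>" "msat F V r (realise \<delta>)" for V \<Phi> \<delta>
    using msat_realise[OF assms(1) eme _ r] abstraction_in_abs_models[OF eme] ident that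
    by (auto simp: abs_class_def abs_class_identifier_def)
  have "msat F V r (rt F r \<sigma> \<Gamma> \<Delta> \<xi>)" if V: "msat F V r \<phi>" for V
    unfolding rt
  proof (intro ballI impI, elim conjE)
    fix \<Phi> \<delta> assume *: "\<Phi> \<in> \<Gamma>" "\<delta> \<in> \<Delta> \<Phi>" "is_cover F V \<sigma> \<Phi>" "msat F V r (realise \<delta>)"
    have "psat (\<lambda>(p, w). V w p) (tr F r \<phi>)" using V by (simp add: psat_tr[OF assms(1)])
    then have "psat (\<lambda>(p, w). V w p) \<xi>"
      using assms(6) by (simp add: uniform_interpolant_def tautology_def)
    moreover have "psat (\<lambda>(p, w). pullback F V \<Phi> (abstraction F V \<Phi>) w p) \<xi> \<longleftrightarrow>
        psat (\<lambda>(p, w). V w p) \<xi>"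
      by (rule psat_cong)
        (use assms(5) pullback_eq[OF eme[OF *(1)] *(3)] in \<open>auto simp: frame_sig_def\<close>)
    ultimately show "\<exists>f\<in>abs_class F r \<Phi> \<delta>. psat (\<lambda>(p, w). pullback F V \<Phi> f w p) \<xi>"
      using g_class[OF *(1,2,4)] by blast
  qed
  moreover have "msat F V r \<psi>"
    if \<psi>: "msig \<psi> \<subseteq> \<sigma>" "MImp \<phi> \<psi> \<in> L" and V: "msat F V r (rt F r \<sigma> \<Gamma> \<Delta> \<xi>)" for \<psi> V
  proof -
    \<comment> \<open>Exhaustiveness of the encoding yields a conjunct of \<open>rt\<close> whose
      antecedent is true in \<open>V\<close>, so \<open>rt\<close> does not hold vacuously.\<close>
    obtain \<Phi> \<delta> where *: "\<Phi> \<in> \<Gamma>" "\<delta> \<in> \<Delta> \<Phi>" "is_cover F V \<sigma> \<Phi>" "msat F V r (realise \<delta>)"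
      using assms(4) unfolding encoding_def by blast
    then obtain f where f: "f \<in> abs_class F r \<Phi> \<delta>"
      and \<xi>: "psat (\<lambda>(p, w). pullback F V \<Phi> f w p) \<xi>"
      using V unfolding rt by blast
    \<comment> \<open>This meets the interpolant's condition on the atoms shared with
      \<open>tr F r \<phi>\<close>.\<close>
    have "psig (tr F r \<psi>) \<subseteq> frame_sig F \<sigma>"
      using psig_tr[OF assms(1) r, of \<psi>] \<psi>(1) by (auto simp: frame_sig_def)
    then have "tautology (PImp \<xi> (tr F r \<psi>))"
      using assms(2,6) \<psi>(2) tautology_tr_iff[OF assms(1)] unfolding uniform_interpolant_def by blast
    with \<xi> have "psat (\<lambda>(p, w). pullback F V \<Phi> f w p) (tr F r \<psi>)"
      by (simp add: tautology_def)
    then have "msat F (pullback F V \<Phi> f) r \<psi>"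
      by (simp add: psat_tr[OF assms(1)])
    \<comment> \<open>Both \<open>f\<close> and the abstraction of \<open>V\<close> lie in the class
      of \<delta>; the resulting bisimulation carries \<psi> from the pullback back to
      \<open>V\<close> at the root.\<close>
    moreover obtain \<beta> where "abs_bisimulation F f (abstraction F V \<Phi>) \<beta>" "(r, r) \<in> \<beta>"
      using abs_class_bisimilar[OF ident[OF *(1,2)] f g_class[OF *(1,2,4)]] .
    ultimately show ?thesis using msat_pullback[OF eme[OF *(1)] *(3)] \<psi>(1) by blast
  qed
  ultimately show ?thesis
    unfolding strongest_implicate_def assms(2) MImp_mem_Log
    using msig_rt[OF assms(1) fin assms(4,5)] by blast
qed

end
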